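(* In Stage I (the central server's stage of the two-stage Stackelberg game described in the context), the optimal reward $R_t^*$ of the central server at the $t$-th iteration can be obtained, according to the clients' optimal correction factors $\alpha_i^{t*}$, as $$R_t^*=\frac{1}{2(1-\gamma)\sum_{i=1}^{K}G_i^t}\sum_{i=1}^{K}\left[\frac{\gamma\theta_i^2G_i^t}{t|\mathcal D_i|^2(G_i^tR_t^*+H_i^t)^2}-H_i^t\right],$$ where $$\rho_i^t=G_i^tR_t+H_i^t,\qquad G_i^t=(\rho_i^{t-1}-\phi(t-1))I_i^t,\qquad H_i^t=(1-J_i^t)\phi(t-1)+J_i^t\rho_i^{t-1},$$ $$I_i^t=\frac{(\rho_i^{t-1}-\phi(t-1))Q_i^t}{2(1-\varphi_i)\big(1-(1-\frac{\rho_i^{t-1}}{N\phi(t-1)})^{K}\big)},\qquad J_i^t=\frac{(\rho_i^{t-1}-\phi(t-1))\{\sum_{j=t+1}^{T}[S(j)\prod_{r=t}^{j-1}\alpha_i^r]+M_i^t\}}{2(1-\varphi_i)\big(1-(1-\frac{\rho_i^{t-1}}{N\phi(t-1)})^{K}\big)}.$$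
   Context: There are $N$ clients, of which $K=\tau N$ are sampled at each global iteration (indexed $1,\dots,K$), $\tau\in(0,1]$. Client $i$ has a dataset $\mathcal D_i$ of size $|\mathcal D_i|$, aggregation weight $\theta_i=|\mathcal D_i|/\sum_{j=1}^N|\mathcal D_j|$, and privacy budget $\rho_i^t$ at iteration $t\in\{0,1,\dots,T\}$. $\gamma\in(0,1)$ and $\varphi_i\in(0,1)$ are weight parameters. The mean-field term $\phi(t)=\frac1N\sum_{i=1}^N\rho_i^t$ is treated as a given function of $t$. Stage I: the server chooses the reward $R_t$ to minimize its cost $$U_t(R_t,\boldsymbol\alpha)=\sum_{i=1}^{K}\Big(\gamma\frac{\theta_i^2}{t|\mathcal D_i|^2\rho_i^t}+(1-\gamma)R_t\rho_i^t\Big).$$ Stage II: given the rewards, client $i$ chooses correction factors $\alpha_i^t\in(0,1)$ to maximize $$\sum_{t=0}^{T}\Big(1-\big(1-\tfrac{\rho_i^t}{N\phi(t)}\big)^{K}\Big)\big(\rho_i^tR_t-\varphi_i(\rho_i^t)^2-(1-\varphi_i)(\alpha_i^t)^2\big)$$ subject to $\rho_i^{t+1}=(1-\alpha_i^t)\phi(t)+\alpha_i^t\rho_i^t$. The client's optimal correction factor is $$\alpha_i^{t*}=\frac{(\rho_i^t-\phi(t))\{\sum_{j=t+2}^{T}[S(j)\prod_{r=t+1}^{j-1}\alpha_i^r]+S(t+1)\}}{2(1-\varphi_i)\big(1-(1-\frac{\rho_i^t}{N\phi(t)})^{K}\big)},\qquad \alpha_i^T=0,$$ with $S(t)=Q_i^tR_t+M_i^t$,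 $$Q_i^t=1-\Big(1-\frac{\rho_i^t}{N\phi(t)}\Big)^{K}+\Big(1-\frac{\rho_i^t}{N\phi(t)}\Big)^{K-1}\frac{K\rho_i^t}{N\phi(t)},$$ $$M_i^t=-2\varphi_i\rho_i^t\Big(1-\Big(1-\frac{\rho_i^t}{N\phi(t)}\Big)^{K}\Big)-\Big(1-\frac{\rho_i^t}{N\phi(t)}\Big)^{K-1}\big(\varphi_i(\rho_i^t)^2+(1-\varphi_i)(\alpha_i^t)^2\big).$$ The optimal reward $R_t^*$ is the reward minimizing the server's cost $U_t$ when the clients' optimal correction factors are substituted into it.
   Formalization: The printed formula for R_t^* is false: the term −H_i^t must carry a factor (1−γ), as differentiating U_t shows. The result proved has −(1−γ)H_i^t in place of −H_i^t; the two agree only when the sum of the H_i^t is zero. *)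

theory Defs
  imports Complex_Main
begin

record fl_game =
  num_clients :: nat                       (* N *)
  num_sampled :: nat                       (* K; the sampled clients are 1, ..., K *)
  horizon :: nat                           (* T *)
  data_size :: "nat \<Rightarrow> nat"
  server_weight :: real                    (* gamma *)
  client_weight :: "nat \<Rightarrow> real"          (* varphi_i *)

text \<open>
  A play of the game adds the rewards \<open>R\<^sub>t\<close> and, with the client as first and the iteration as
  second argument, the privacy budgets \<open>\<rho>\<^sub>i\<^sup>t\<close> and the correction factors \<open>\<alpha>\<^sub>i\<^sup>t\<close>.
\<close>

record fl_play = fl_game +
  reward :: "nat \<Rightarrow> real"
  budget :: "nat \<Rightarrow> nat \<Rightarrow> real"
  corr :: "nat \<Rightarrow> nat \<Rightarrow> real"

definition agg_weight :: "'a fl_game_scheme \<Rightarrow> nat \<Rightarrow> real" where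
  "agg_weight g i = real (data_size g i) / (\<Sum>j=1..num_clients g. real (data_size g j))"

definition mean_field :: "'a fl_play_scheme \<Rightarrow> nat \<Rightarrow> real" where
  "mean_field g t = (1 / real (num_clients g)) * (\<Sum>i=1..num_clients g. budget g i t)"

definition budget_share :: "'a fl_play_scheme \<Rightarrow> nat \<Rightarrow> nat \<Rightarrow> real" where
  "budget_share g i t = budget g i t / (real (num_clients g) * mean_field g t)"

definition selection_prob :: "'a fl_play_scheme \<Rightarrow> nat \<Rightarrow> nat \<Rightarrow> real" where
  "selection_prob g i t = 1 - (1 - budget_share g i t) ^ num_sampled g"

definition Q_coef :: "'a fl_play_scheme \<Rightarrow> nat \<Rightarrow> nat \<Rightarrow> real" where
  "Q_coef g i t = 1 - (1 - budget_share g i t) ^ num_sampled g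
     + (1 - budget_share g i t) ^ (num_sampled g - 1) * (real (num_sampled g) * budget_share g i t)"

definition M_coef :: "'a fl_play_scheme \<Rightarrow> nat \<Rightarrow> nat \<Rightarrow> real" where
  "M_coef g i t =
     - 2 * client_weight g i * budget g i t * (1 - (1 - budget_share g i t) ^ num_sampled g)
     - (1 - budget_share g i t) ^ (num_sampled g - 1)
       * (client_weight g i * (budget g i t)\<^sup>2 + (1 - client_weight g i) * (corr g i t)\<^sup>2)"

definition S_coef :: "'a fl_play_scheme \<Rightarrow> nat \<Rightarrow> nat \<Rightarrow> real" where
  "S_coef g i t = Q_coef g i t * reward g t + M_coef g i t"

definition opt_corr :: "'a fl_play_scheme \<Rightarrow> nat \<Rightarrow> nat \<Rightarrow> real" where
  "opt_corr g i t =
     (if t < horizon g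
      then (budget g i t - mean_field g t)
             * ((\<Sum>j=t+2..horizon g. S_coef g i j * (\<Prod>r=t+1..j-1. corr g i r)) + S_coef g i (t+1))
           / (2 * (1 - client_weight g i) * selection_prob g i t)
      else 0)"

text \<open>
  The clients' reaction at iteration \<open>t \<ge> 1\<close> to a candidate reward \<open>x\<close> replacing \<open>R\<^sub>t\<close>: only
  \<open>R\<^sub>t\<close> is varied in the closed form of \<open>\<alpha>\<^sub>i\<^sup>t\<^sup>-\<^sup>1\<close>, while the mean field, \<open>Q\<^sub>i\<^sup>t\<close>, \<open>M\<^sub>i\<^sup>t\<close> and the
  later terms keep their values along the play.
\<close>

definition corr_response :: "'a fl_play_scheme \<Rightarrow> nat \<Rightarrow> nat \<Rightarrow> real \<Rightarrow> real" where
  "corr_response g i t x = opt_corr (g\<lparr>reward := (reward g)(t := x)\<rparr>) i (t - 1)"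

definition budget_response :: "'a fl_play_scheme \<Rightarrow> nat \<Rightarrow> nat \<Rightarrow> real \<Rightarrow> real" where
  "budget_response g i t x =
     (1 - corr_response g i t x) * mean_field g (t - 1) + corr_response g i t x * budget g i (t - 1)"

definition server_cost ::
  "'a fl_game_scheme \<Rightarrow> nat \<Rightarrow> real \<Rightarrow> (nat \<Rightarrow> real) \<Rightarrow> real" where
  "server_cost g t x \<rho> = (\<Sum>i=1..num_sampled g.
     server_weight g * ((agg_weight g i)\<^sup>2 / (real t * (real (data_size g i))\<^sup>2 * \<rho> i))
     + (1 - server_weight g) * x * \<rho> i)"

definition admissible_reward :: "'a fl_play_scheme \<Rightarrow> nat \<Rightarrow> real \<Rightarrow> bool" where
  "admissible_reward g t x \<longleftrightarrow>
     (\<forall>i\<in>{1..num_clients g}. 0 < corr_response g i t x \<and> corr_response g i t x < 1)"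

definition optimal_reward :: "'a fl_play_scheme \<Rightarrow> nat \<Rightarrow> real \<Rightarrow> bool" where
  "optimal_reward g t =
     is_arg_min (\<lambda>x. server_cost g t x (\<lambda>i. budget_response g i t x)) (admissible_reward g t)"

definition valid_game :: "'a fl_game_scheme \<Rightarrow> bool" where
  "valid_game g \<longleftrightarrow>
     0 < num_clients g
     \<and> (\<exists>\<tau>::real. 0 < \<tau> \<and> \<tau> \<le> 1 \<and> real (num_sampled g) = \<tau> * real (num_clients g))
     \<and> (\<forall>i\<in>{1..num_clients g}. 0 < data_size g i)
     \<and> 0 < server_weight g \<and> server_weight g < 1
     \<and> (\<forall>i\<in>{1..num_clients g}. 0 < client_weight g i \<and> client_weight g i < 1)"

definition client_optimal_play :: "'a fl_play_scheme \<Rightarrow> bool" where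
  "client_optimal_play g \<longleftrightarrow> (\<forall>i\<in>{1..num_clients g}.
     (\<forall>t\<le>horizon g. 0 < budget g i t)
     \<and> (\<forall>t\<le>horizon g. corr g i t = opt_corr g i t)
     \<and> (\<forall>t<horizon g. 0 < corr g i t \<and> corr g i t < 1)
     \<and> (\<forall>t<horizon g. budget g i (t+1)
          = (1 - corr g i t) * mean_field g t + corr g i t * budget g i t))"

definition I_coef :: "'a fl_play_scheme \<Rightarrow> nat \<Rightarrow> nat \<Rightarrow> real" where
  "I_coef g i t = (budget g i (t-1) - mean_field g (t-1)) * Q_coef g i t
     / (2 * (1 - client_weight g i) * selection_prob g i (t-1))"

definition J_coef :: "'a fl_play_scheme \<Rightarrow> nat \<Rightarrow> nat \<Rightarrow> real" where
  "J_coef g i t = (budget g i (t-1) - mean_field g (t-1))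
     * ((\<Sum>j=t+1..horizon g. S_coef g i j * (\<Prod>r=t..j-1. corr g i r)) + M_coef g i t)
     / (2 * (1 - client_weight g i) * selection_prob g i (t-1))"

definition G_coef :: "'a fl_play_scheme \<Rightarrow> nat \<Rightarrow> nat \<Rightarrow> real" where
  "G_coef g i t = (budget g i (t-1) - mean_field g (t-1)) * I_coef g i t"

text \<open>
  With \<open>\<rho>\<^sub>i\<^sup>t = G\<^sub>i\<^sup>t x + H\<^sub>i\<^sup>t\<close> the product \<open>(1 - \<gamma>) x \<rho>\<^sub>i\<^sup>t\<close> in the server's cost has derivative
  \<open>(1 - \<gamma>) (2 G\<^sub>i\<^sup>t x + H\<^sub>i\<^sup>t)\<close>, so \<open>H\<^sub>i\<^sup>t\<close> enters the stationarity equation for the reward with the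
  factor \<open>1 - \<gamma>\<close>. The formula in the source omits this factor and is false without it.
\<close>

definition H_coef :: "'a fl_play_scheme \<Rightarrow> nat \<Rightarrow> nat \<Rightarrow> real" where
  "H_coef g i t = (1 - J_coef g i t) * mean_field g (t-1) + J_coef g i t * budget g i (t-1)"

end

theory Submission
  imports Defs
begin

text \<open>
  The optimal correction factor of iteration \<open>t - 1\<close> is affine in \<open>R\<^sub>t\<close>, hence so is the resulting
  budget, \<open>\<rho>\<^sub>i\<^sup>t = G\<^sub>i\<^sup>t R\<^sub>t + H\<^sub>i\<^sup>t\<close>. The constraint \<open>0 < \<alpha>\<^sub>i < 1\<close> is open, so an optimal reward is an
  interior minimum of the server's cost and the derivative vanishes there; this is the asserted
  equation once \<open>\<Sum> G\<^sub>i\<^sup>t \<noteq> 0\<close> is known. A nonzero correction factor forces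
  \<open>\<rho>\<^sub>i\<^sup>t\<^sup>-\<^sup>1 \<noteq> \<phi>(t - 1)\<close>, which excludes \<open>N = 1\<close>; then all budget shares lie strictly between 0 and 1
  and every \<open>G\<^sub>i\<^sup>t\<close> is positive.
\<close>

text \<open>The lower bound keeps sums over the sampled clients nonempty; the upper bound carries
  facts about all clients over to the sampled ones.\<close>

lemma valid_game_sampled:
  assumes "valid_game g"
  shows "1 \<le> num_sampled g" "num_sampled g \<le> num_clients g"
proof -
  obtain \<tau> :: real where \<tau>: "0 < \<tau>" "\<tau> \<le> 1"
      "real (num_sampled g) = \<tau> * real (num_clients g)" and N: "0 < num_clients g"
    using assms unfolding valid_game_def by auto
  have "0 < real (num_sampled g)"
    using \<tau> N by simp
  then show "1 \<le> num_sampled g" by simp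
  have "real (num_sampled g) \<le> real (num_clients g)"
    using \<tau> N by (simp add: mult_left_le_one_le)
  then show "num_sampled g \<le> num_clients g" by simp
qed

text \<open>In the closed form at \<open>t - 1\<close> the reward \<open>R\<^sub>t\<close> occurs
  only in the summand \<open>S(t)\<close>; its \<open>Q\<close> part gives the slope and its
  \<open>M\<close> part joins the later terms in the intercept.\<close>

lemma corr_response_affine:
  assumes "1 \<le> t" "t \<le> horizon g"
  shows "corr_response g i t x = I_coef g i t * x + J_coef g i t"
proof -
  let ?g = "g\<lparr>reward := (reward g)(t := x)\<rparr>"
  have S: "S_coef ?g i j = (if j = t then Q_coef g i t * x + M_coef g i t else S_coef g i j)" for j
    by (simp add: S_coef_def Q_coef_def M_coef_def budget_share_def mean_field_def)
  have later: "(\<Sum>j=t+1..horizon g. S_coef ?g i j * (\<Prod>r=t..j-1. corr g i r))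
      = (\<Sum>j=t+1..horizon g. S_coef g i j * (\<Prod>r=t..j-1. corr g i r))"
    by (rule sum.cong) (auto simp: S)
  \<comment> \<open>The first fact selects the nonzero branch of \<open>opt_corr\<close>; the others
    need \<open>1 \<le> t\<close> because subtraction is truncated.\<close>
  have idx: "t - 1 < horizon g" "t - 1 + 2 = t + 1" "t - 1 + 1 = t"
    using assms by auto
  have "corr_response g i t x = (budget g i (t-1) - mean_field g (t-1))
      * ((\<Sum>j=t+1..horizon g. S_coef ?g i j * (\<Prod>r=t..j-1. corr g i r)) + S_coef ?g i t)
      / (2 * (1 - client_weight g i) * selection_prob g i (t-1))"
    unfolding corr_response_def opt_corr_def idx using idx(1)
    by (simp add: selection_prob_def budget_share_def mean_field_def)
  then show ?thesis
    unfolding later S I_coef_def J_coef_def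
    by (simp add: add_divide_distrib[symmetric] algebra_simps)
qed

lemma budget_response_affine:
  assumes "1 \<le> t" "t \<le> horizon g"
  shows "budget_response g i t x = G_coef g i t * x + H_coef g i t"
  unfolding budget_response_def corr_response_affine[OF assms] G_coef_def H_coef_def
  by (simp add: algebra_simps)

text \<open>Writing the reward of the play back into itself changes nothing, so the response there
  is the budget prescribed by the dynamics.\<close>

lemma budget_eq_response:
  fixes g :: "'a fl_play_scheme"
  assumes "client_optimal_play g" "1 \<le> t" "t \<le> horizon g" "i \<in> {1..num_clients g}"
  shows "budget g i t = budget_response g i t (reward g t)"
proof -
  have t: "t - 1 < horizon g" "t - 1 \<le> horizon g" "t - 1 + 1 = t"
    using assms by auto
  have "budget g i (t - 1 + 1) = (1 - corr g i (t-1)) * mean_field g (t-1)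
      + corr g i (t-1) * budget g i (t-1)" "corr g i (t-1) = opt_corr g i (t-1)"
    using assms(1,4) t(1,2) unfolding client_optimal_play_def by blast+
  then show ?thesis
    unfolding t(3) budget_response_def corr_response_def by simp
qed

lemma num_clients_mean_field:
  assumes "0 < num_clients g"
  shows "real (num_clients g) * mean_field g t = (\<Sum>i=1..num_clients g. budget g i t)"
  using assms unfolding mean_field_def by simp

text \<open>The share is a client's part of the total budget; a second client with positive budget
  makes the upper bound strict.\<close>

lemma budget_share_bounds:
  assumes "2 \<le> num_clients g" and pos: "\<And>i. i \<in> {1..num_clients g} \<Longrightarrow> 0 < budget g i t"
    and i: "i \<in> {1..num_clients g}"
  shows "0 < budget_share g i t" "budget_share g i t < 1"
proof -
  let ?A = "{1..num_clients g}"
  \<comment> \<open>Some client other than \<open>i\<close>, so that the remaining sum is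
    nonempty.\<close>
  define j :: nat where "j = (if i = 1 then 2 else 1)"
  have j: "j \<in> ?A - {i}" using assms(1) by (auto simp: j_def)
  have "(\<Sum>k\<in>?A. budget g k t) = budget g i t + (\<Sum>k\<in>?A - {i}. budget g k t)"
    using i by (simp add: sum.remove)
  moreover have "0 < (\<Sum>k\<in>?A - {i}. budget g k t)"
    by (rule sum_pos) (use j pos in blast)+
  ultimately have "budget g i t < (\<Sum>k\<in>?A. budget g k t)" by simp
  then show "0 < budget_share g i t" "budget_share g i t < 1"
    using pos[OF i] assms(1) unfolding budget_share_def
    by (simp_all add: num_clients_mean_field)
qed

lemma selection_prob_pos:
  assumes "1 \<le> num_sampled g" "0 < budget_share g i t" "budget_share g i t < 1"
  shows "0 < selection_prob g i t"
proof -
  have "(1 - budget_share g i t) ^ num_sampled g < 1"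
    using assms by (simp add: power_less_one_iff)
  then show ?thesis unfolding selection_prob_def by simp
qed

text \<open>With s the share and p(s) the selection probability, \<open>Q_coef\<close> is p(s) + s
  p'(s): a positive term plus a nonnegative one.\<close>

lemma Q_coef_pos:
  assumes "1 \<le> num_sampled g" "0 < budget_share g i t" "budget_share g i t < 1"
  shows "0 < Q_coef g i t"
proof -
  have "0 \<le> (1 - budget_share g i t) ^ (num_sampled g - 1)
      * (real (num_sampled g) * budget_share g i t)"
    using assms by simp
  then show ?thesis
    using selection_prob_pos[OF assms] unfolding Q_coef_def selection_prob_def by linarith
qed

text \<open>The deviation from the mean field enters once through \<open>I_coef\<close> and once
  through the budget update, so it appears squared and its sign is irrelevant.\<close>

lemma G_coef_pos:
  assumes "valid_game g" "client_optimal_play g" "1 \<le> t" "t \<le> horizon g"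
    and i: "i \<in> {1..num_clients g}"
  shows "0 < G_coef g i t"
proof -
  have t: "t - 1 < horizon g" using assms by auto
  have "corr g i (t-1) = opt_corr g i (t-1)" "0 < corr g i (t-1)"
    using assms(2) i t less_imp_le[OF t] unfolding client_optimal_play_def by blast+
  then have ne: "budget g i (t-1) \<noteq> mean_field g (t-1)"
    using t unfolding opt_corr_def by auto
  have N2: "2 \<le> num_clients g"
  proof (rule ccontr)
    assume "\<not> 2 \<le> num_clients g"
    then have "num_clients g = 1" "i = 1" using i by auto
    then show False using ne by (simp add: mean_field_def)
  qed
  have pos: "0 < budget g k s" if "k \<in> {1..num_clients g}" "s \<le> horizon g" for k s
    using assms(2) that unfolding client_optimal_play_def by blast
  \<comment> \<open>Used at two iterations: \<open>t - 1\<close> for the selection probability and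
    \<open>t\<close> for \<open>Q_coef\<close>.\<close>
  note share = budget_share_bounds[OF N2 pos i]
  have "0 < selection_prob g i (t-1)" "0 < Q_coef g i t"
    using share t assms(4) valid_game_sampled(1)[OF assms(1)]
    by (auto intro!: selection_prob_pos Q_coef_pos)
  moreover have "client_weight g i < 1"
    using assms(1) i unfolding valid_game_def by blast
  moreover have "G_coef g i t = (budget g i (t-1) - mean_field g (t-1))\<^sup>2 * Q_coef g i t
      / (2 * (1 - client_weight g i) * selection_prob g i (t-1))"
    unfolding G_coef_def I_coef_def by (simp add: power2_eq_square)
  ultimately show ?thesis using ne by simp
qed

text \<open>Admissibility is a finite conjunction of strict inequalities between continuous
  functions of the reward, hence an open condition.\<close>

lemma eventually_admissible_reward:
  assumes "1 \<le> t" "t \<le> horizon g" "admissible_reward g t x"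
  shows "eventually (admissible_reward g t) (nhds x)"
proof -
  have "open {y. 0 < corr_response g i t y \<and> corr_response g i t y < 1}" for i
    unfolding corr_response_affine[OF assms(1,2)]
    by (intro open_Collect_conj open_Collect_less continuous_intros)
  then have "eventually (\<lambda>y. 0 < corr_response g i t y \<and> corr_response g i t y < 1) (nhds x)"
    if "i \<in> {1..num_clients g}" for i
    using assms(3) that eventually_nhds_in_open unfolding admissible_reward_def by fastforce
  then show ?thesis
    unfolding admissible_reward_def by (simp add: eventually_ball_finite)
qed

lemma DERIV_server_cost_affine:
  assumes "\<And>i. i \<in> {1..num_sampled g} \<Longrightarrow> G i * x + H i \<noteq> 0"
  shows "((\<lambda>x. server_cost g t x (\<lambda>i. G i * x + H i)) has_real_derivative
    (1 - server_weight g) * (2 * x * (\<Sum>i=1..num_sampled g. G i))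
    - (\<Sum>i=1..num_sampled g. server_weight g * (agg_weight g i)\<^sup>2 * G i
         / (real t * (real (data_size g i))\<^sup>2 * (G i * x + H i)\<^sup>2)
         - (1 - server_weight g) * H i)) (at x)"
proof -
  \<comment> \<open>Isolates the reciprocal of the budget from the constant factors, so that
    differentiation asks only for a nonzero budget.\<close>
  have split: "server_weight g * ((agg_weight g i)\<^sup>2 / (real t * (real (data_size g i))\<^sup>2 * r))
      = server_weight g * (agg_weight g i)\<^sup>2 / (real t * (real (data_size g i))\<^sup>2) * inverse r"
    for i r by (simp add: divide_inverse)
  have "((\<lambda>x. server_cost g t x (\<lambda>i. G i * x + H i)) has_real_derivative
     (\<Sum>i=1..num_sampled g.
        server_weight g * (agg_weight g i)\<^sup>2 / (real t * (real (data_size g i))\<^sup>2)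
          * (- G i / (G i * x + H i)\<^sup>2)
        + (1 - server_weight g) * (2 * x * G i + H i))) (at x)"
    unfolding server_cost_def split
    by (rule DERIV_sum, (rule derivative_eq_intros refl assms | assumption)+)
       (simp only: divide_inverse power2_eq_square inverse_mult_distrib, simp add: algebra_simps)
  also have "(\<Sum>i=1..num_sampled g.
        server_weight g * (agg_weight g i)\<^sup>2 / (real t * (real (data_size g i))\<^sup>2)
          * (- G i / (G i * x + H i)\<^sup>2)
        + (1 - server_weight g) * (2 * x * G i + H i))
     = (1 - server_weight g) * (2 * x * (\<Sum>i=1..num_sampled g. G i))
       - (\<Sum>i=1..num_sampled g. server_weight g * (agg_weight g i)\<^sup>2 * G i
         / (real t * (real (data_size g i))\<^sup>2 * (G i * x + H i)\<^sup>2)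
         - (1 - server_weight g) * H i)"
    unfolding sum_distrib_left sum_subtractf[symmetric]
    by (rule sum.cong) (simp_all add: algebra_simps)
  finally show ?thesis .
qed

theorem lemma2:
  fixes g :: fl_play and t :: nat
  assumes "valid_game g"
    and "client_optimal_play g"
    and "1 \<le> t" and "t \<le> horizon g"
    and "optimal_reward g t (reward g t)"
  shows "(\<forall>i\<in>{1..num_sampled g}.
            budget g i t = G_coef g i t * reward g t + H_coef g i t
            \<and> (\<forall>x. budget_response g i t x = G_coef g i t * x + H_coef g i t))
         \<and> reward g t =
            1 / (2 * (1 - server_weight g) * (\<Sum>i=1..num_sampled g. G_coef g i t))
            * (\<Sum>i=1..num_sampled g.
                 server_weight g * (agg_weight g i)\<^sup>2 * G_coef g i t
                   / (real t * (real (data_size g i))\<^sup>2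
                      * (G_coef g i t * reward g t + H_coef g i t)\<^sup>2)
                 - (1 - server_weight g) * H_coef g i t)"
proof -
  let ?x = "reward g t" and ?G = "\<lambda>i. G_coef g i t" and ?H = "\<lambda>i. H_coef g i t"
  let ?f = "\<lambda>x. server_cost g t x (\<lambda>i. ?G i * x + ?H i)"
  let ?W = "\<Sum>i=1..num_sampled g. server_weight g * (agg_weight g i)\<^sup>2 * ?G i
      / (real t * (real (data_size g i))\<^sup>2 * (?G i * ?x + ?H i)\<^sup>2)
      - (1 - server_weight g) * ?H i"
  note K = valid_game_sampled[OF assms(1)]
  note response = budget_response_affine[OF assms(3,4)]
  have client: "i \<in> {1..num_clients g}" if "i \<in> {1..num_sampled g}" for i
    using that K(2) by auto
  have budget: "budget g i t = ?G i * ?x + ?H i" if "i \<in> {1..num_sampled g}" for i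
    using budget_eq_response[OF assms(2-4) client[OF that]] response by simp
  \<comment> \<open>At the reward of the play the affine expression is an actual budget, hence
    positive, and the cost is differentiable there.\<close>
  have "?G i * ?x + ?H i \<noteq> 0" if "i \<in> {1..num_sampled g}" for i
  proof -
    have "0 < budget g i t"
      using assms(2,4) client[OF that] unfolding client_optimal_play_def by blast
    then show ?thesis using budget[OF that] by simp
  qed
  note deriv = DERIV_server_cost_affine[where t = t, OF this]
  have opt: "admissible_reward g t ?x" "\<And>y. admissible_reward g t y \<Longrightarrow> ?f ?x \<le> ?f y"
    using assms(5) unfolding optimal_reward_def is_arg_min_def response
    by (auto simp: not_less)
  obtain d where d: "0 < d" "\<And>y. dist y ?x < d \<Longrightarrow> admissible_reward g t y"
    using eventually_admissible_reward[OF assms(3,4) opt(1)]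
    unfolding eventually_nhds_metric by blast
  \<comment> \<open>All rewards within \<open>d\<close> are admissible competitors, so the
    constrained minimum is a two-sided local one.\<close>
  have "(1 - server_weight g) * (2 * ?x * (\<Sum>i=1..num_sampled g. ?G i)) - ?W = 0"
    by (rule DERIV_local_min[OF deriv d(1)])
       (auto intro!: opt(2) d(2) simp: dist_real_def abs_minus_commute)
  moreover have "0 < (\<Sum>i=1..num_sampled g. ?G i)"
    using K(1) by (intro sum_pos G_coef_pos assms(1-4) client) auto
  moreover have "server_weight g < 1"
    using assms(1) unfolding valid_game_def by blast
  \<comment> \<open>Only the linear occurrence of \<open>?x\<close> is solved for; \<open>?W\<close>
    still contains \<open>?x\<close>, so the result is a fixed-point equation.\<close>
  ultimately have "?x = 1 / (2 * (1 - server_weight g) * (\<Sum>i=1..num_sampled g. ?G i)) * ?W"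
    by (simp add: field_simps)
  then show ?thesis using budget response by blast
qed

end
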